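(* Let $O$ be an octonion division algebra over a field $F$, let $c_0,c_1\in O$ with $c_0\neq 0$, and consider the left linear recurrence of order $2$ $$a_{k+2}=-c_0a_k-c_1a_{k+1}\qquad(k\ge 0)$$ with fixed initial conditions $a_0,a_1\in O$. Let $p(x)=x^2+c_1x+c_0\in O[x]$ be its primitive characteristic polynomial, and let $\overline{p(x)}=x^2+\overline{c_1}x+\overline{c_0}$ be the conjugate polynomial. Assume that $p(x)$ has two distinct roots $\lambda_1,\mu_1\in O$. Then $\overline{p(x)}$ also has two distinct roots $\lambda_2,\mu_2\in O$, in the same conjugacy class as $\lambda_1,\mu_1$, respectively, and there exist a quaternion subalgebra $Q\subset O$ containing the coefficients of $p(x)$, an element $\ell\in O$ with $\ell+\bar\ell=0$ and $O=Q\oplus Q\ell$, and constants $b_1,b_2,c_1',c_2'\in Q$ such that the solution of the left linear recurrence with these initial conditions is $$a_k=\lambda_1^kb_1+\mu_1^kb_2+\left(c_1'\,\bar{\lambda}_2^{\,k}+c_2'\,\bar{\mu}_2^{\,k}\right)\ell\qquad\text{for all }k\ge 0.$$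
   Context: An octonion algebra over $F$ is an $8$-dimensional (non-associative, unital, alternative) $F$-algebra obtained by the Cayley--Dickson doubling process from a quaternion algebra $A$ over $F$ with its standard involution $\sigma$: for $\gamma\in F^\times$ it is $A\oplus A\ell$ with multiplication $$(q+r\ell)(s+t\ell)=qs+\gamma\,\sigma(t)r+(tq+r\sigma(s))\ell,\qquad q,r,s,t\in A,$$ and with involution $\sigma(q+r\ell)=\sigma(q)-r\ell$. It is an octonion division algebra if it is a division algebra. The involution is written $\tau\mapsto\bar\tau$, and the trace of $\tau$ is $\tau+\bar\tau$. Polynomials in $O[x]$ have a central indeterminate $x$ and coefficients on the left; $\lambda\in O$ is a root of $x^2+c_1x+c_0$ if $\lambda^2+c_1\lambda+c_0=0$. Two elements $d_1,d_2\in O$ are conjugate if $d_1=qd_2q^{-1}$ for some nonzero $q\in O$ (well defined since any two elements of $O$ generate an associative subalgebra). The conjugacy class of an element is the set of its conjugates.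
   Formalization: Added assumption: if F has characteristic 2, it is not the case that c_0 and c_1 commute with 1, c_0, c_1 linearly independent over F; in that case no quaternion subalgebra contains both coefficients, so the printed conclusion fails. *)

theory Defs
  imports Complex_Main
begin

(* The type classes on 'o only provide the symbols 0, +, -, 1, *, ^; no associativity is implied.
   Powers are x ^ 0 = 1 and x ^ Suc k = x * x ^ k; the algebras below are power-associative. *)
locale unital_algebra = vector_space scale
  for scale :: "'f::field \<Rightarrow> 'o::{ab_group_add, power} \<Rightarrow> 'o" +
  assumes mult_one_left: "1 * (x::'o) = x"
    and mult_one_right: "(x::'o) * 1 = x"
    and mult_add_left: "((x::'o) + y) * z = x * z + y * z"
    and mult_add_right: "(x::'o) * (y + z) = x * y + x * z"
    and mult_scale_left: "scale a x * y = scale a (x * y)"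
    and mult_scale_right: "x * scale a y = scale a (x * y)"

definition scalars :: "('f::field \<Rightarrow> 'o::{ab_group_add, power} \<Rightarrow> 'o) \<Rightarrow> 'o set" where
  "scalars scale = range (\<lambda>a. scale a 1)"

definition subalgebra :: "('f::field \<Rightarrow> 'o::{ab_group_add, power} \<Rightarrow> 'o) \<Rightarrow> 'o set \<Rightarrow> bool" where
  "subalgebra scale A \<longleftrightarrow>
     module.subspace scale A \<and> 1 \<in> A \<and> (\<forall>x\<in>A. \<forall>y\<in>A. x * y \<in> A)"

definition two_sided_ideal ::
  "('f::field \<Rightarrow> 'o::{ab_group_add, power} \<Rightarrow> 'o) \<Rightarrow> 'o set \<Rightarrow> 'o set \<Rightarrow> bool" where
  "two_sided_ideal scale A I \<longleftrightarrow>
     module.subspace scale I \<and> I \<subseteq> A \<and> (\<forall>x\<in>A. \<forall>y\<in>I. x * y \<in> I \<and> y * x \<in> I)"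

(* A quaternion algebra over F is a central simple (associative) F-algebra of dimension 4;
   this covers every characteristic. *)
definition quaternion_subalgebra ::
  "('f::field \<Rightarrow> 'o::{ab_group_add, power} \<Rightarrow> 'o) \<Rightarrow> 'o set \<Rightarrow> bool" where
  "quaternion_subalgebra scale A \<longleftrightarrow>
     subalgebra scale A \<and>
     (\<forall>x\<in>A. \<forall>y\<in>A. \<forall>z\<in>A. (x * y) * z = x * (y * z)) \<and>
     vector_space.dim scale A = 4 \<and>
     {z \<in> A. \<forall>x\<in>A. z * x = x * z} = scalars scale \<and>
     (\<forall>I. two_sided_ideal scale A I \<longrightarrow> I = {0} \<or> I = A)"

(* On a quaternion algebra these conditions determine \<sigma> uniquely. *)
definition standard_involution_on ::
  "('f::field \<Rightarrow> 'o::{ab_group_add, power} \<Rightarrow> 'o) \<Rightarrow> 'o set \<Rightarrow> ('o \<Rightarrow> 'o) \<Rightarrow> bool" where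
  "standard_involution_on scale A \<sigma> \<longleftrightarrow>
     (\<forall>x\<in>A. \<sigma> x \<in> A \<and> \<sigma> (\<sigma> x) = x) \<and>
     (\<forall>x\<in>A. \<forall>y\<in>A. \<sigma> (x + y) = \<sigma> x + \<sigma> y \<and> \<sigma> (x * y) = \<sigma> y * \<sigma> x) \<and>
     (\<forall>a. \<forall>x\<in>A. \<sigma> (scale a x) = scale a (\<sigma> x)) \<and>
     (\<forall>x\<in>A. x + \<sigma> x \<in> scalars scale \<and> x * \<sigma> x \<in> scalars scale)"

(* The whole algebra is the direct sum of A and A * l. *)
definition direct_sum_with :: "'o::{ab_group_add, power} set \<Rightarrow> 'o \<Rightarrow> bool" where
  "direct_sum_with A l \<longleftrightarrow> (\<forall>x. \<exists>!p. p \<in> A \<times> A \<and> x = fst p + snd p * l)"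

(* Internal form of the doubling: the ambient algebra with the map bar is the double of the
   quaternion algebra A with its standard involution (the restriction of bar) and parameter \<gamma>. *)
definition cayley_dickson ::
  "('f::field \<Rightarrow> 'o::{ab_group_add, power} \<Rightarrow> 'o) \<Rightarrow> ('o \<Rightarrow> 'o) \<Rightarrow> 'o set \<Rightarrow> 'o \<Rightarrow> 'f \<Rightarrow> bool" where
  "cayley_dickson scale bar A l \<gamma> \<longleftrightarrow>
     quaternion_subalgebra scale A \<and> standard_involution_on scale A bar \<and>
     \<gamma> \<noteq> 0 \<and> direct_sum_with A l \<and>
     (\<forall>q\<in>A. \<forall>r\<in>A. \<forall>s\<in>A. \<forall>t\<in>A.
        (q + r * l) * (s + t * l)
          = (q * s + scale \<gamma> (bar t * r)) + (t * q + r * bar s) * l) \<and>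
     (\<forall>q\<in>A. \<forall>r\<in>A. bar (q + r * l) = bar q - r * l)"

locale octonion_algebra = unital_algebra scale
  for scale :: "'f::field \<Rightarrow> 'o::{ab_group_add, power} \<Rightarrow> 'o" +
  fixes bar :: "'o \<Rightarrow> 'o"
  assumes doubling: "\<exists>A l \<gamma>. cayley_dickson scale bar A l \<gamma>"

locale octonion_division_algebra = octonion_algebra scale bar
  for scale :: "'f::field \<Rightarrow> 'o::{ab_group_add, power} \<Rightarrow> 'o" and bar :: "'o \<Rightarrow> 'o" +
  assumes division: "(x::'o) \<noteq> 0 \<Longrightarrow> bij (\<lambda>y. x * y) \<and> bij (\<lambda>y. y * x)"

(* The element q' is the inverse of q. *)
definition conjugacy_class :: "'o::{ab_group_add, power} \<Rightarrow> 'o set" where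
  "conjugacy_class d = {(q * d) * q' | q q'. q \<noteq> 0 \<and> q * q' = 1 \<and> q' * q = 1}"

(* x is a root of the monic quadratic polynomial with left coefficients 1, c1, c0. *)
definition quadratic_root :: "'o::{ab_group_add, power} \<Rightarrow> 'o \<Rightarrow> 'o \<Rightarrow> bool" where
  "quadratic_root c1 c0 x \<longleftrightarrow> x ^ 2 + c1 * x + c0 = 0"

definition left_recurrence ::
  "'o::{ab_group_add, power} \<Rightarrow> 'o \<Rightarrow> (nat \<Rightarrow> 'o) \<Rightarrow> bool" where
  "left_recurrence c0 c1 a \<longleftrightarrow> (\<forall>k. a (k + 2) = - (c0 * a k) - c1 * a (k + 1))"

(* In an octonion division algebra this says that F has characteristic 2 and that x, y generate a
   purely inseparable field extension of degree 4 of F. Such a field can occur in characteristic 2,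
   and then no quaternion subalgebra contains both x and y. Every other pair of elements is
   contained in a quaternion subalgebra; in particular every pair if F has characteristic
   different from 2. *)
definition inseparable_pair ::
  "('f::field \<Rightarrow> 'o::{ab_group_add, power} \<Rightarrow> 'o) \<Rightarrow> 'o \<Rightarrow> 'o \<Rightarrow> bool" where
  "inseparable_pair scale x y \<longleftrightarrow>
     (2::'f) = 0 \<and> x * y = y * x \<and> vector_space.dim scale {1, x, y} = 3"

end

theory Submission
  imports Defs
begin

text \<open>
  The octonion algebra is a composition algebra: its trace \<open>tr\<close> and norm \<open>nrm\<close> are scalar valued and
  \<open>bar x * (x * y) = nrm x y\<close>. Polarizing this identity shows that a vector \<open>v\<close> orthogonal to a
  subalgebra \<open>D\<close> multiplies with \<open>D\<close> by the Cayley--Dickson rule (\<open>perp_double_mult\<close>), and that the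
  existence of a nonzero such \<open>v\<close> makes \<open>D\<close> associative (\<open>perp_associative\<close>). Starting from a
  separable quadratic subalgebra one obtains a quaternion subalgebra \<open>Q\<close> and then the whole algebra
  \<open>Q + Q l\<close> (\<open>Q_cayley_dickson\<close>). In this way any two elements that are not an inseparable pair lie in
  such a \<open>Q\<close> (\<open>pair_quaternion\<close>).

  A root \<open>x\<close> of the polynomial satisfies \<open>(tr x + c1) * x = nrm x - c0\<close>. If the coefficients are not
  both scalar, the first factor is nonzero, so \<open>x\<close> lies in every \<open>Q\<close> containing the coefficients and is
  determined by its trace and norm. The analogous equation for the conjugate polynomial has a
  solution with the same trace and norm (\<open>conjugate_root\<close>), which is a conjugate of \<open>x\<close>
  (\<open>conjugate_in_Q\<close>); distinct roots give distinct solutions. If the coefficients are scalar, the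
  polynomial equals its conjugate, the same two roots serve again, and \<open>Q\<close> is chosen to contain them.

  Finally, \<open>c * (w * l) = (w * c) * l\<close> for \<open>c, w\<close> in \<open>Q\<close>. The recurrence therefore splits into one in \<open>Q\<close>
  with coefficients on the left and one in \<open>Q\<close> with coefficients on the right, and \<open>bar\<close> turns the latter
  into the recurrence of the conjugate polynomial. In the associative division algebra \<open>Q\<close> both are
  solved by powers of two distinct roots (\<open>recurrence_solution\<close>).
\<close>

section \<open>Unital algebras and Cayley--Dickson doubles\<close>

context unital_algebra
begin

lemma zero_mult [simp]: "0 * (x::'o) = 0"
  using mult_add_left[of 0 0 x] by simp

lemma mult_zero [simp]: "(x::'o) * 0 = 0"
  using mult_add_right[of x 0 0] by simp

lemma minus_mult [simp]: "(- x) * (y::'o) = - (x * y)"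
  using mult_add_left[of x "- x" y] by (simp add: eq_neg_iff_add_eq_0 add.commute)

lemma mult_minus [simp]: "x * (- (y::'o)) = - (x * y)"
  using mult_add_right[of x y "- y"] by (simp add: eq_neg_iff_add_eq_0 add.commute)

lemma mult_diff_left: "(x - y) * (z::'o) = x * z - y * z"
  using mult_add_left[of x "- y" z] by simp

lemma mult_diff_right: "x * (y - (z::'o)) = x * y - x * z"
  using mult_add_right[of x y "- z"] by simp

lemmas bilinear = mult_add_left mult_add_right mult_diff_left mult_diff_right
  mult_scale_left mult_scale_right
lemmas linear_simps = scale_right_distrib scale_left_distrib scale_right_diff_distrib
  scale_left_diff_distrib

declare mult_one_left [simp] mult_one_right [simp]

lemma scalarsI [intro, simp]: "scale a 1 \<in> scalars scale"
  by (auto simp: scalars_def)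

lemma scalarsE: "x \<in> scalars scale \<Longrightarrow> (\<And>a. x = scale a 1 \<Longrightarrow> P) \<Longrightarrow> P"
  by (auto simp: scalars_def)

end

text \<open>A unital algebra presented as the double \<open>A + A l\<close> of a quaternion subalgebra \<open>A\<close>. It serves to
  verify once, in coordinates, the identities of trace and norm.\<close>
locale doubled_algebra = unital_algebra scale
  for scale :: "'f::field \<Rightarrow> 'o::{ab_group_add, power} \<Rightarrow> 'o" +
  fixes bar :: "'o \<Rightarrow> 'o" and A :: "'o set" and l :: 'o and \<gamma> :: 'f
  assumes cd: "cayley_dickson scale bar A l \<gamma>"
begin

lemma quat: "quaternion_subalgebra scale A"
  and inv: "standard_involution_on scale A bar"
  and ds: "direct_sum_with A l"
  and dbl: "\<lbrakk>q \<in> A; r \<in> A; s \<in> A; t \<in> A\<rbrakk> \<Longrightarrow> (q + r * l) * (s + t * l)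
          = (q * s + scale \<gamma> (bar t * r)) + (t * q + r * bar s) * l"
  and bar_dbl: "\<lbrakk>q \<in> A; r \<in> A\<rbrakk> \<Longrightarrow> bar (q + r * l) = bar q - r * l"
  using cd by (auto simp: cayley_dickson_def)

lemma subspA: "subspace A"
  using quat by (auto simp: quaternion_subalgebra_def subalgebra_def)

lemma in_A [simp]: "0 \<in> A" "1 \<in> A"
  "x \<in> A \<Longrightarrow> y \<in> A \<Longrightarrow> x + y \<in> A" "x \<in> A \<Longrightarrow> y \<in> A \<Longrightarrow> x - y \<in> A"
  "x \<in> A \<Longrightarrow> scale a x \<in> A" "x \<in> A \<Longrightarrow> - x \<in> A"
  "x \<in> A \<Longrightarrow> y \<in> A \<Longrightarrow> x * y \<in> A" "x \<in> A \<Longrightarrow> bar x \<in> A"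
  using subspA quat inv
  by (auto simp: subspace_0 subspace_add subspace_diff subspace_scale subspace_neg
      quaternion_subalgebra_def subalgebra_def standard_involution_on_def)

lemma assocA: "x \<in> A \<Longrightarrow> y \<in> A \<Longrightarrow> z \<in> A \<Longrightarrow> (x * y) * z = x * (y * z)"
  using quat by (auto simp: quaternion_subalgebra_def)

lemma barA: "x \<in> A \<Longrightarrow> bar (bar x) = x"
  "x \<in> A \<Longrightarrow> y \<in> A \<Longrightarrow> bar (x + y) = bar x + bar y"
  "x \<in> A \<Longrightarrow> y \<in> A \<Longrightarrow> bar (x * y) = bar y * bar x"
  "x \<in> A \<Longrightarrow> bar (scale a x) = scale a (bar x)"
  using inv by (auto simp: standard_involution_on_def)

lemma bar_minusA: "x \<in> A \<Longrightarrow> bar (- x) = - bar x"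
  using barA(4)[of x "-1"] by simp

lemma dblE:
  obtains q r where "q \<in> A" "r \<in> A" "x = q + r * l"
  using ds unfolding direct_sum_with_def by (metis mem_Times_iff)

lemma bar_add: "bar (x + y) = bar x + bar y"
proof -
  obtain q r where 1: "q \<in> A" "r \<in> A" "x = q + r * l" by (rule dblE)
  obtain s t where 2: "s \<in> A" "t \<in> A" "y = s + t * l" by (rule dblE)
  have "x + y = (q + s) + (r + t) * l" using 1 2 by (simp add: bilinear algebra_simps)
  then have "bar (x + y) = bar (q + s) - (r + t) * l" using 1 2 by (simp only: bar_dbl in_A)
  then show ?thesis using 1 2 by (simp add: bar_dbl barA bilinear)
qed

lemma bar_scale: "bar (scale a x) = scale a (bar x)"
proof -
  obtain q r where 1: "q \<in> A" "r \<in> A" "x = q + r * l" by (rule dblE)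
  have "scale a x = scale a q + scale a r * l" using 1 by (simp add: bilinear linear_simps)
  then have "bar (scale a x) = bar (scale a q) - scale a r * l" using 1 by (simp only: bar_dbl in_A)
  then show ?thesis using 1 by (simp add: bar_dbl barA bilinear linear_simps)
qed

lemma bar_bar: "bar (bar x) = x"
proof -
  obtain q r where 1: "q \<in> A" "r \<in> A" "x = q + r * l" by (rule dblE)
  have "bar x = bar q + (- r) * l" using 1 by (simp add: bar_dbl)
  then show ?thesis using 1 bar_dbl[of "bar q" "- r"] by (simp add: barA)
qed

lemma bar_mult: "bar (x * y) = bar y * bar x"
proof -
  obtain q r where 1: "q \<in> A" "r \<in> A" "x = q + r * l" by (rule dblE)
  obtain s t where 2: "s \<in> A" "t \<in> A" "y = s + t * l" by (rule dblE)
  have b: "bar x = bar q + (- r) * l" "bar y = bar s + (- t) * l" using 1 2 by (simp_all add: bar_dbl)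
  have "bar y * bar x = bar (q * s) + scale \<gamma> (bar (bar t * r)) - (t * q + r * bar s) * l"
    unfolding b using 1 2
    by (subst dbl) (simp_all add: barA bar_minusA bilinear algebra_simps)
  moreover have "bar (x * y) = bar (q * s + scale \<gamma> (bar t * r)) - (t * q + r * bar s) * l"
    using 1 2 by (simp add: dbl bar_dbl)
  ultimately show ?thesis using 1 2 by (simp add: barA)
qed

lemma traceA: "q \<in> A \<Longrightarrow> \<exists>a. q + bar q = scale a 1"
  using inv by (force simp: standard_involution_on_def scalars_def)

lemma normA:
  assumes "q \<in> A"
  obtains a where "q * bar q = scale a 1" "bar q * q = scale a 1"
proof -
  obtain a where a: "q * bar q = scale a 1"
    using inv assms by (force simp: standard_involution_on_def scalars_def)
  obtain t where "q + bar q = scale t 1" using traceA assms by blast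
  then have "bar q = scale t 1 - q" by (simp add: algebra_simps)
  then have "bar q * q = q * bar q" by (simp add: bilinear)
  with a have "bar q * q = scale a 1" by simp
  with a that show ?thesis by blast
qed

lemma trace_scalar: "\<exists>a. x + bar x = scale a 1"
proof -
  obtain q r where 1: "q \<in> A" "r \<in> A" "x = q + r * l" by (rule dblE)
  then show ?thesis using traceA[OF 1(1)] by (simp add: bar_dbl)
qed

text \<open>The norm \<open>x * bar x\<close> is a scalar, and left multiplication by \<open>bar x\<close> inverts left multiplication
  by \<open>x\<close> up to this scalar; the second property replaces associativity below.\<close>
lemma norm_scalar: "\<exists>a. x * bar x = scale a 1 \<and> (\<forall>y. bar x * (x * y) = scale a y)"
proof -
  obtain q r where 1: "q \<in> A" "r \<in> A" "x = q + r * l" by (rule dblE)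
  obtain n where n: "q * bar q = scale n 1" "bar q * q = scale n 1" using normA 1 by blast
  obtain m where m: "r * bar r = scale m 1" "bar r * r = scale m 1" using normA 1 by blast
  have b: "bar x = bar q + (- r) * l" using 1 by (simp add: bar_dbl)
  have "x * bar x = scale n 1 - scale (\<gamma> * m) 1"
    unfolding b unfolding 1(3) using 1 n m by (subst dbl) (simp_all add: barA bar_minusA bilinear)
  moreover have "bar x * (x * y) = scale (n - \<gamma> * m) y" for y
  proof -
    obtain s t where 2: "s \<in> A" "t \<in> A" "y = s + t * l" by (rule dblE)
    have l: "bar q * (q * z) = scale n z" "bar r * (r * z) = scale m z"
      "r * (bar r * z) = scale m z" if "z \<in> A" for z
      using that 1 n m by (simp_all flip: assocA add: bilinear)
    have rr: "z * (r * bar r) = scale m z" "z * (q * bar q) = scale n z"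
       "z * (bar r * r) = scale m z" "z * (bar q * q) = scale n z" if "z \<in> A" for z
      using that 1 n m by (simp_all add: bilinear)
    have xy: "x * y = (q * s + scale \<gamma> (bar t * r)) + (t * q + r * bar s) * l"
      using 1 2 by (simp add: dbl)
    show ?thesis unfolding b xy
      using 1 2 by (subst dbl) (simp_all add: barA bar_minusA bilinear linear_simps assocA l rr algebra_simps)
  qed
  ultimately show ?thesis by (metis scale_left_diff_distrib)
qed

lemma one_neq_zero: "(1::'o) \<noteq> 0"
proof
  assume "(1::'o) = 0"
  then have "x = (0::'o)" for x using mult_one_left[of x] by simp
  then have "A \<subseteq> span ({}::'o set)" by auto
  then have "dim A \<le> card ({}::'o set)" by (rule dim_le_card) simp
  then show False using quat by (simp add: quaternion_subalgebra_def)
qed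

lemma not_commutativeA: "\<exists>x\<in>A. \<exists>y\<in>A. x * y \<noteq> y * x"
proof (rule ccontr)
  assume "\<not> ?thesis"
  then have "A = scalars scale" using quat by (auto simp: quaternion_subalgebra_def)
  also have "\<dots> = span {1}" by (simp add: scalars_def span_singleton)
  finally have "dim A \<le> card {1::'o}" by (intro dim_le_card) auto
  then show False using quat by (simp add: quaternion_subalgebra_def)
qed

lemma not_associative: "\<exists>x y z::'o. (x * y) * z \<noteq> x * (y * z)"
proof (rule ccontr)
  assume as: "\<not> ?thesis"
  obtain x y where xy: "x \<in> A" "y \<in> A" "x * y \<noteq> y * x" using not_commutativeA by blast
  have "x * (y * l) = (y * x) * l" using xy dbl[of x 0 0 y] by simp
  with as have "(x * y) * l = (y * x) * l" by metis
  then have "0 + (x * y) * l = 0 + (y * x) * l" by simp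
  then show False using xy ds unfolding direct_sum_with_def
    by (metis in_A(1,7) mem_Times_iff fst_conv snd_conv)
qed

end

section \<open>Trace, norm and polar form of an octonion algebra\<close>

context octonion_algebra
begin

lemma doubledE: obtains A l \<gamma> where "doubled_algebra scale bar A l \<gamma>"
  using doubling unital_algebra_axioms
  by (auto simp: doubled_algebra_def doubled_algebra_axioms_def)

lemma one_neq_zero [simp]: "(1::'o) \<noteq> 0"
  by (rule doubledE) (rule doubled_algebra.one_neq_zero)
lemma not_commutative: "\<exists>x y::'o. x * y \<noteq> y * x"
  by (rule doubledE) (metis doubled_algebra.not_commutativeA)
lemma not_associative: "\<exists>x y z::'o. (x * y) * z \<noteq> x * (y * z)"
  by (rule doubledE) (rule doubled_algebra.not_associative)
lemma bar_add [simp]: "bar (x + y) = bar x + bar y"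
  by (rule doubledE) (rule doubled_algebra.bar_add)
lemma bar_scale [simp]: "bar (scale a x) = scale a (bar x)"
  by (rule doubledE) (rule doubled_algebra.bar_scale)
lemma bar_bar [simp]: "bar (bar x) = x"
  by (rule doubledE) (rule doubled_algebra.bar_bar)
lemma bar_mult [simp]: "bar (x * y) = bar y * bar x"
  by (rule doubledE) (rule doubled_algebra.bar_mult)
lemma bar_zero [simp]: "bar 0 = 0"
  using bar_scale[of 0 0] by simp
lemma bar_minus [simp]: "bar (- x) = - bar x"
  using bar_scale[of "- 1" x] by simp
lemma bar_diff [simp]: "bar (x - y) = bar x - bar y"
  using bar_add[of x "- y"] by simp
lemma bar_one [simp]: "bar 1 = 1"
  using bar_mult[of "bar 1" 1] by simp

text \<open>The trace, as an element of the base field. The choice is unique because \<open>1 \<noteq> 0\<close>.\<close>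
definition tr :: "'o \<Rightarrow> 'f" where
  "tr x = (SOME a. x + bar x = scale a 1)"

text \<open>The norm, as an element of the base field.\<close>
definition nrm :: "'o \<Rightarrow> 'f" where
  "nrm x = (SOME a. x * bar x = scale a 1)"

text \<open>The polar form of the norm, see \<open>nrm_add\<close> below; it is meaningful in every characteristic.\<close>
definition bil :: "'o \<Rightarrow> 'o \<Rightarrow> 'f" where
  "bil x y = tr (x * bar y)"

lemma add_bar: "x + bar x = scale (tr x) 1"
proof -
  have "\<exists>a. x + bar x = scale a 1" by (rule doubledE) (rule doubled_algebra.trace_scalar)
  then show ?thesis unfolding tr_def by (rule someI_ex)
qed

lemma bar_eq: "bar x = scale (tr x) 1 - x"
  using add_bar[of x] by (simp add: algebra_simps)

lemma tr_eqI: "x + bar x = scale a 1 \<Longrightarrow> tr x = a"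
  using add_bar[of x] by simp

lemma tr_add [simp]: "tr (x + y) = tr x + tr y"
proof (rule tr_eqI)
  have "x + y + bar (x + y) = (x + bar x) + (y + bar y)" by (simp add: algebra_simps)
  then show "x + y + bar (x + y) = scale (tr x + tr y) 1" by (simp only: add_bar scale_left_distrib)
qed
lemma tr_scale [simp]: "tr (scale a x) = a * tr x"
proof (rule tr_eqI)
  have "scale a x + bar (scale a x) = scale a (x + bar x)" by (simp add: algebra_simps)
  then show "scale a x + bar (scale a x) = scale (a * tr x) 1" by (simp add: add_bar)
qed
lemma tr_minus [simp]: "tr (- x) = - tr x"
  using tr_scale[of "- 1" x] by simp
lemma tr_diff [simp]: "tr (x - y) = tr x - tr y"
  using tr_add[of x "- y"] by simp
lemma tr_zero [simp]: "tr 0 = 0"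
  by (rule tr_eqI) simp
lemma tr_one [simp]: "tr 1 = 2"
  by (rule tr_eqI) (metis bar_one one_add_one scale_left_distrib scale_one)
lemma tr_bar [simp]: "tr (bar x) = tr x"
  by (rule tr_eqI) (simp add: add.commute add_bar)

lemma nrm_props: "x * bar x = scale (nrm x) 1" "bar x * (x * y) = scale (nrm x) y"
proof -
  have *: "\<exists>a. x * bar x = scale a 1 \<and> (\<forall>y. bar x * (x * y) = scale a y)"
    by (rule doubledE) (rule doubled_algebra.norm_scalar)
  then have "\<exists>a. x * bar x = scale a 1" by blast
  then show 1: "x * bar x = scale (nrm x) 1" unfolding nrm_def by (rule someI_ex)
  with * show "bar x * (x * y) = scale (nrm x) y" by auto
qed

lemma nrm_eqI: "x * bar x = scale a 1 \<Longrightarrow> nrm x = a"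
  using nrm_props(1)[of x] by simp

lemma mult_bar: "x * bar x = scale (nrm x) 1" "bar x * x = scale (nrm x) 1"
  using nrm_props[of x] nrm_props(2)[of x 1] by simp_all

lemma nrm_bar [simp]: "nrm (bar x) = nrm x"
  by (rule nrm_eqI) (simp add: mult_bar)
lemma nrm_scale [simp]: "nrm (scale a x) = a * a * nrm x"
  by (rule nrm_eqI) (simp add: mult_bar bilinear)
lemma nrm_zero [simp]: "nrm 0 = 0"
  by (rule nrm_eqI) simp

lemma bar_cancel [simp]: "bar x * (x * y) = scale (nrm x) y" "x * (bar x * y) = scale (nrm x) y"
  "(y * x) * bar x = scale (nrm x) y" "(y * bar x) * x = scale (nrm x) y"
proof -
  show 1: "bar x * (x * y) = scale (nrm x) y" "x * (bar x * y) = scale (nrm x) y" for x y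
    using nrm_props(2)[of x y] nrm_props(2)[of "bar x" y] by simp_all
  have "bar ((y * x) * bar x) = bar (scale (nrm x) y)" using 1(2)[of x "bar y"] by simp
  then show "(y * x) * bar x = scale (nrm x) y" by (metis bar_bar)
  have "bar ((y * bar x) * x) = bar (scale (nrm x) y)" using 1(1)[of x "bar y"] by simp
  then show "(y * bar x) * x = scale (nrm x) y" by (metis bar_bar)
qed

lemma mult_self: "x * x = scale (tr x) x - scale (nrm x) 1"
proof -
  have "x * (scale (tr x) 1 - x) = scale (nrm x) 1" using mult_bar(1)[of x] by (simp only: bar_eq)
  then show ?thesis by (simp add: bilinear algebra_simps)
qed

lemma tr_mult_commute: "tr (x * y) = tr (y * x)"
proof (rule tr_eqI)
  have "x * y + bar (x * y) = y * x + bar (y * x)"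
    by (simp add: bar_eq[of x] bar_eq[of y] bilinear algebra_simps)
  then show "x * y + bar (x * y) = scale (tr (y * x)) 1" by (simp only: add_bar)
qed

lemma bil_sym: "bil x y = bil y x"
  unfolding bil_def using tr_bar[of "x * bar y"] by simp

lemma bil_bar [simp]: "bil (bar x) (bar y) = bil x y"
  using bil_sym[of x y] by (simp add: bil_def tr_mult_commute[of "bar x" y])

lemma bil_linear [simp]:
  "bil (x + y) z = bil x z + bil y z" "bil z (x + y) = bil z x + bil z y"
  "bil (x - y) z = bil x z - bil y z" "bil z (x - y) = bil z x - bil z y"
  "bil (scale a x) z = a * bil x z" "bil z (scale a x) = a * bil z x"
  "bil 0 z = 0" "bil z 0 = 0" "bil (- x) z = - bil x z" "bil z (- x) = - bil z x"
  by (simp_all add: bil_def bilinear)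

lemma bil_one [simp]: "bil x 1 = tr x" "bil 1 x = tr x"
  by (simp_all add: bil_def)

lemma bil_self: "bil x x = 2 * nrm x"
  by (simp add: bil_def mult_bar)

lemma mult_bar_add: "x * bar y + y * bar x = scale (bil x y) 1"
  using add_bar[of "x * bar y"] by (simp add: bil_def)

lemma nrm_add: "nrm (x + y) = nrm x + nrm y + bil x y"
  by (rule nrm_eqI)
     (simp add: bilinear mult_bar mult_bar_add[symmetric] scale_left_distrib algebra_simps)

text \<open>Polarizations of the identities \<open>bar_cancel\<close> with respect to the repeated factor.\<close>
lemma left_linearized: "bar x * (z * y) + bar z * (x * y) = scale (bil x z) y"
  using bar_cancel(1)[of "x + z" y]
  by (simp add: bilinear nrm_add linear_simps algebra_simps del: bar_cancel(1))
     (simp add: bilinear algebra_simps)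

lemma right_linearized: "(y * x) * bar z + (y * z) * bar x = scale (bil x z) y"
proof -
  have "bar ((y * x) * bar z + (y * z) * bar x) = bar (scale (bil x z) y)"
    using left_linearized[of "bar x" "bar z" "bar y"] by (simp add: add.commute)
  then show ?thesis by (metis bar_bar)
qed

text \<open>Although the algebra is not associative, the trace of a product of three factors does not depend
  on the bracketing.\<close>
lemma tr_assoc: "tr ((x * y) * z) = tr (x * (y * z))"
proof -
  have rot: "tr ((y * x) * w) = tr (x * (w * y))" for x y w
  proof -
    have "tr ((y * x) * w) + tr ((y * bar w) * bar x) = bil x (bar w) * tr y"
      using right_linearized[of y x "bar w"] by (metis bar_bar tr_add tr_scale)
    moreover have "tr ((y * bar w) * bar x) = tr (x * (w * bar y))"
      using tr_bar[of "(y * bar w) * bar x"] by simp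
    moreover have "tr (x * (w * bar y)) = tr y * tr (x * w) - tr (x * (w * y))"
      by (simp add: bar_eq[of y] bilinear)
    ultimately show ?thesis by (simp add: bil_def algebra_simps)
  qed
  have "tr ((x * y) * z) = tr (z * (x * y))" by (rule tr_mult_commute)
  also have "\<dots> = tr ((y * z) * x)" by (rule rot[symmetric])
  also have "\<dots> = tr (x * (y * z))" by (rule tr_mult_commute)
  finally show ?thesis .
qed

lemma bil_mult_right: "bil z (e * v) = bil (z * bar v) e"
  by (simp add: bil_def tr_assoc)

text \<open>If the trace vanished, then \<open>2 = 0\<close> and \<open>bar\<close> would be the identity, so that the
  algebra would be commutative.\<close>
lemma tr_nonzero: "\<exists>x. tr x \<noteq> 0"
proof (rule ccontr)
  assume "\<not> ?thesis"
  then have 0: "tr x = 0" for x by blast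
  have "bar x = x" for x
  proof -
    have "(2::'f) = 0" using 0[of 1] by simp
    then have "scale 2 x = 0" by simp
    then have "x + x = 0" by (metis one_add_one scale_left_distrib scale_one)
    moreover have "bar x + x = 0" using bar_eq[of x] 0 by simp
    ultimately show ?thesis by (metis add_right_cancel)
  qed
  then have "x * y = y * x" for x y :: 'o using bar_mult[of x y] by simp
  then show False using not_commutative by blast
qed

section \<open>Doubling a subalgebra by an orthogonal vector\<close>

text \<open>The orthogonal complement with respect to the polar form.\<close>
definition perp :: "'o set \<Rightarrow> 'o set" where
  "perp D = {z. \<forall>d\<in>D. bil z d = 0}"

text \<open>The set \<open>D + D v\<close>.\<close>
definition double :: "'o set \<Rightarrow> 'o \<Rightarrow> 'o set" where
  "double D v = {a + b * v | a b. a \<in> D \<and> b \<in> D}"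

text \<open>Every vector has an orthogonal projection to \<open>D\<close>, that is, the whole space is
  \<open>D + perp D\<close>. For a finite-dimensional \<open>D\<close> this says that the polar form is nondegenerate
  on \<open>D\<close>, since it is nondegenerate on the whole algebra; in this form the property passes to
  doubles without any dimension count.\<close>
definition complemented :: "'o set \<Rightarrow> bool" where
  "complemented D \<longleftrightarrow> (\<forall>z. \<exists>d\<in>D. z - d \<in> perp D)"

lemma perp_bil: "z \<in> perp D \<Longrightarrow> d \<in> D \<Longrightarrow> bil z d = 0"
  by (simp add: perp_def)

lemma subalgebra_in:
  assumes "subalgebra scale D"
  shows "0 \<in> D" "1 \<in> D" "x \<in> D \<Longrightarrow> y \<in> D \<Longrightarrow> x + y \<in> D" "x \<in> D \<Longrightarrow> y \<in> D \<Longrightarrow> x - y \<in> D"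
    "x \<in> D \<Longrightarrow> scale a x \<in> D" "x \<in> D \<Longrightarrow> - x \<in> D" "x \<in> D \<Longrightarrow> y \<in> D \<Longrightarrow> x * y \<in> D"
  using assms by (auto simp: subalgebra_def subspace_0 subspace_add subspace_diff subspace_scale
      subspace_neg)

lemma subalgebra_bar:
  assumes "subalgebra scale D" "x \<in> D"
  shows "bar x \<in> D"
  using assms by (simp add: bar_eq subalgebra_in)

context
  fixes D :: "'o set" and v :: 'o
  assumes sub: "subalgebra scale D" and v: "v \<in> perp D"
begin

lemmas in_D = subalgebra_in[OF sub] subalgebra_bar[OF sub]

lemma perp_bar: "bar v = - v"
proof -
  have "tr v = 0" using perp_bil[OF v, of 1] by (simp add: in_D)
  then show ?thesis by (simp add: bar_eq)
qed

lemma perp_commute: "a \<in> D \<Longrightarrow> v * a = bar a * v"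
  using mult_bar_add[of v "bar a"] perp_bil[OF v, of "bar a"] by (simp add: in_D perp_bar)

lemma perp_bar_mult: "a \<in> D \<Longrightarrow> bar (a * v) = - (a * v)"
  using perp_commute[of "bar a"] by (simp add: in_D perp_bar)

lemma perp_left_mult:
  assumes "a \<in> D" "b \<in> D"
  shows "a * (b * v) = (b * a) * v"
proof -
  have "a * (v * bar b) + bar v * (bar a * bar b) = 0"
    using left_linearized[of "bar a" v "bar b"] perp_bil[OF v, of "bar a"] assms
    by (simp add: bil_sym in_D)
  moreover have "v * bar b = b * v" using perp_commute[of "bar b"] assms by (simp add: in_D)
  moreover have "v * (bar a * bar b) = (b * a) * v"
    using perp_commute[of "bar (b * a)"] assms by (simp add: in_D)
  ultimately show ?thesis by (simp add: perp_bar)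
qed

lemma perp_right_mult:
  assumes "a \<in> D" "b \<in> D"
  shows "(a * v) * b = (a * bar b) * v"
  using right_linearized[of a v "bar b"] perp_bil[OF v, of "bar b"] assms
  by (simp add: in_D perp_bar)

lemma bil_perp_right: "a \<in> D \<Longrightarrow> b \<in> D \<Longrightarrow> bil (a * v) (b * v) = nrm v * bil a b"
  by (simp add: bil_mult_right)

lemma bil_perp_mixed:
  assumes "a \<in> D" "b \<in> D"
  shows "bil (a * v) b = 0"
proof -
  have "(a * v) * bar b + b * bar (a * v) = 0"
    using assms by (simp add: perp_left_mult perp_right_mult perp_bar_mult in_D del: bar_mult)
  then show ?thesis by (simp add: mult_bar_add del: bar_mult)
qed

lemma perp_mult_perp:
  assumes "a \<in> D" "b \<in> D"
  shows "(a * v) * (b * v) = scale (- nrm v) (bar b * a)"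
proof -
  have "(a * v) * (v * bar b) + bar v * (- (a * v) * bar b) = scale (bil (- (a * v)) v) (bar b)"
    using left_linearized[of "- (a * v)" v "bar b"] assms by (simp add: perp_bar_mult del: bar_mult)
  moreover have "bil (- (a * v)) v = - nrm v * tr a"
    using bil_perp_right[of a 1] assms by (simp add: in_D)
  moreover have "v * bar b = b * v" using perp_commute[of "bar b"] assms by (simp add: in_D)
  moreover have "bar v * (- (a * v) * bar b) = - scale (nrm v) (bar b * bar a)"
  proof -
    have "(a * v) * bar b = v * bar (a * b)"
      using perp_commute[of "bar (a * b)"] assms by (simp add: perp_right_mult in_D)
    then show ?thesis by simp
  qed
  moreover have "scale (tr a) (bar b) = bar b * (a + bar a)"
    by (simp only: add_bar mult_scale_right mult_one_right)
  ultimately show ?thesis by (simp add: bilinear linear_simps flip: scale_scale)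
qed

text \<open>A vector orthogonal to a subalgebra \<open>D\<close> multiplies with \<open>D\<close> as in the Cayley--Dickson
  doubling with parameter \<open>- nrm v\<close>.\<close>
lemma perp_double_mult:
  assumes "a \<in> D" "b \<in> D" "c \<in> D" "d \<in> D"
  shows "(a + b * v) * (c + d * v)
    = (a * c + scale (- nrm v) (bar d * b)) + (d * a + b * bar c) * v"
  using assms by (simp add: bilinear perp_left_mult perp_right_mult perp_mult_perp algebra_simps)

lemma perp_double_bar:
  assumes "a \<in> D" "b \<in> D"
  shows "bar (a + b * v) = bar a - b * v"
  using assms by (simp add: perp_bar_mult del: bar_mult)

lemma doubleI: "a \<in> D \<Longrightarrow> b \<in> D \<Longrightarrow> a + b * v \<in> double D v"
  by (auto simp: double_def)

lemma double_base: "D \<subseteq> double D v"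
  using doubleI[of _ 0] by (auto simp: in_D)

lemma double_gen: "v \<in> double D v"
  using doubleI[of 0 1] by (auto simp: in_D)

lemma subalgebra_double: "subalgebra scale (double D v)"
  unfolding subalgebra_def
proof (intro conjI ballI subspaceI)
  show "0 \<in> double D v" "1 \<in> double D v" using double_base by (auto simp: in_D)
next
  fix x y assume "x \<in> double D v" "y \<in> double D v"
  then obtain a b c d where *: "a \<in> D" "b \<in> D" "c \<in> D" "d \<in> D" "x = a + b * v" "y = c + d * v"
    by (auto simp: double_def)
  have "x + y = (a + c) + (b + d) * v" using * by (simp add: bilinear algebra_simps)
  then show "x + y \<in> double D v" using *(1-4) by (metis doubleI in_D(3))
  show "x * y \<in> double D v" using * by (simp only: perp_double_mult) (intro doubleI in_D; simp add: in_D)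
next
  fix c x assume "x \<in> double D v"
  then obtain a b where *: "a \<in> D" "b \<in> D" "x = a + b * v" by (auto simp: double_def)
  have "scale c x = scale c a + scale c b * v" using * by (simp add: bilinear algebra_simps)
  then show "scale c x \<in> double D v" using * doubleI by (simp add: in_D)
qed

end

end

context octonion_division_algebra
begin

lemma mult_eq_0_iff [simp]: "x * y = 0 \<longleftrightarrow> x = 0 \<or> y = (0::'o)"
proof
  assume 0: "x * y = 0"
  show "x = 0 \<or> y = 0"
  proof (rule ccontr)
    assume "\<not> ?thesis"
    with division[of x] have "inj (\<lambda>y. x * y)" "y \<noteq> 0" by (auto simp: bij_def)
    from injD[OF this(1), of y 0] this(2) 0 show False by simp
  qed
qed auto

lemma mult_right_cancel: "z \<noteq> 0 \<Longrightarrow> x * z = y * z \<longleftrightarrow> x = (y::'o)"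
  using mult_eq_0_iff[of "x - y" z] by (simp add: mult_diff_left)

lemma mult_left_cancel: "z \<noteq> 0 \<Longrightarrow> z * x = z * y \<longleftrightarrow> x = (y::'o)"
  using mult_eq_0_iff[of z "x - y"] by (simp add: mult_diff_right)

lemma nrm_eq_0_iff [simp]: "nrm x = 0 \<longleftrightarrow> x = 0"
proof
  assume "nrm x = 0"
  then have "x * bar x = 0" by (simp add: mult_bar)
  then show "x = 0" by (metis bar_bar bar_zero mult_eq_0_iff)
qed simp

lemma bil_nondegenerate:
  assumes "\<And>z. bil d z = 0"
  shows "d = 0"
proof (rule ccontr)
  assume "d \<noteq> 0"
  obtain x where "tr x \<noteq> 0" using tr_nonzero by blast
  then show False using assms[of "x * d"] \<open>d \<noteq> 0\<close> by (simp add: bil_mult_right mult_bar)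
qed

text \<open>A vector of \<open>D\<close> orthogonal to \<open>D\<close> is orthogonal to everything, hence zero.\<close>
lemma complemented_perp_disjoint:
  assumes "complemented D" "d \<in> D" "d \<in> perp D"
  shows "d = 0"
proof (rule bil_nondegenerate)
  fix z
  obtain e where e: "e \<in> D" "z - e \<in> perp D" using assms(1) unfolding complemented_def by blast
  have "bil z d = bil d e" using perp_bil[OF e(2) assms(2)] by (simp add: bil_sym[of d])
  then show "bil d z = 0" using perp_bil[OF assms(3) e(1)] by (simp add: bil_sym[of d z])
qed

text \<open>A subalgebra that admits a nonzero orthogonal vector is associative: the polarized
  cancellation identity, applied to vectors of \<open>D v\<close>, turns into the associative law of \<open>D\<close>.\<close>
lemma perp_associative:
  assumes sub: "subalgebra scale D" and v: "v \<in> perp D" "v \<noteq> 0" and D: "a \<in> D" "b \<in> D" "c \<in> D"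
  shows "(a * b) * c = a * (b * c)"
proof -
  note P = perp_left_mult[OF sub v(1)] perp_right_mult[OF sub v(1)] perp_mult_perp[OF sub v(1)]
    perp_bar_mult[OF sub v(1)] bil_perp_mixed[OF sub v(1)] subalgebra_in[OF sub] subalgebra_bar[OF sub]
  have "a * ((c * v) * (bar b * v)) + bar (c * v) * (bar a * (bar b * v)) = 0"
    using left_linearized[of "bar a" "c * v" "bar b * v"] D by (simp add: bil_sym[of "bar a"] P)
  then have "scale (nrm v) (a * (b * c)) = scale (nrm v) ((a * b) * c)"
    using D by (simp add: P bilinear del: scale_cancel_left bar_mult) auto
  then show ?thesis using v by auto
qed

text \<open>The projection to \<open>D v\<close> is that of \<open>z * bar v\<close> to \<open>D\<close>, divided by \<open>nrm v\<close> and multiplied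
  by \<open>v\<close>.\<close>
lemma complemented_double:
  assumes sub: "subalgebra scale D" and c: "complemented D" and v: "v \<in> perp D" "v \<noteq> 0"
  shows "complemented (double D v)"
  unfolding complemented_def
proof
  fix z
  obtain d where d: "d \<in> D" "z - d \<in> perp D" using c unfolding complemented_def by blast
  obtain r where r: "r \<in> D" "z * bar v - r \<in> perp D" using c unfolding complemented_def by blast
  define s where "s = scale (inverse (nrm v)) r"
  have s: "s \<in> D" using r by (simp add: s_def subalgebra_in[OF sub])
  have "bil (z - (d + s * v)) (e + f * v) = 0" if ef: "e \<in> D" "f \<in> D" for e f
  proof -
    have "bil z e = bil d e" using perp_bil[OF d(2) ef(1)] by simp
    moreover have "bil z (f * v) = nrm v * bil s f"
      using perp_bil[OF r(2) ef(2)] v by (simp add: bil_mult_right s_def)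
    ultimately show ?thesis using bil_perp_mixed[OF sub v(1)] bil_perp_right[OF sub v(1)] ef d s
      by (simp add: bil_sym[of d])
  qed
  then show "\<exists>d\<in>double D v. z - d \<in> perp (double D v)"
    using d s by (intro bexI[of _ "d + s * v"]) (auto simp: perp_def double_def simp del: bil_linear)
qed

lemma double_unique:
  assumes sub: "subalgebra scale D" and c: "complemented D" and v: "v \<in> perp D" "v \<noteq> 0"
    and D: "a \<in> D" "b \<in> D" "c \<in> D" "d \<in> D" and eq: "a + b * v = c + d * v"
  shows "a = c \<and> b = d"
proof -
  have e: "a - c = (d - b) * v" using eq by (simp add: bilinear algebra_simps)
  have "(d - b) * v \<in> perp D"
    using bil_perp_mixed[OF sub v(1)] D by (simp add: perp_def subalgebra_in[OF sub])
  moreover have "a - c \<in> D" using D by (simp add: subalgebra_in[OF sub])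
  ultimately have "a - c = 0" using complemented_perp_disjoint[OF c] e by metis
  then show ?thesis using e v by simp
qed

end

section \<open>Quaternion subalgebras containing a given pair\<close>

context octonion_algebra
begin

text \<open>The discriminant of the minimal polynomial \<open>X\<^sup>2 - tr u X + nrm u\<close> of a nonscalar \<open>u\<close>. When it is
  nonzero, \<open>u\<close> generates a separable quadratic subalgebra, in every characteristic.\<close>
definition disc :: "'o \<Rightarrow> 'f" where
  "disc u = tr u * tr u - 4 * nrm u"

lemma in_span_one_gen: "x \<in> span {u, 1} \<longleftrightarrow> (\<exists>a b. x = scale a 1 + scale b u)"
  by (auto simp: span_breakdown_eq[of _ u] span_singleton image_iff algebra_simps) (metis add.commute)+

lemma span_one_genI: "scale a 1 + scale b u \<in> span {u, 1}"
  by (auto simp: in_span_one_gen)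

lemma span_one_gen_commute:
  assumes "x \<in> span {u, 1}" "y \<in> span {u, 1}"
  shows "x * y = y * x"
  using assms by (auto simp: in_span_one_gen bilinear algebra_simps)

lemma subalgebra_span_one_gen: "subalgebra scale (span {u, 1})"
  unfolding subalgebra_def
proof (intro conjI ballI)
  fix x y assume "x \<in> span {u, 1}" "y \<in> span {u, 1}"
  then obtain a b c d where *: "x = scale a 1 + scale b u" "y = scale c 1 + scale d u"
    by (auto simp: in_span_one_gen)
  have "x * y = scale (a * c - b * d * nrm u) 1 + scale (a * d + b * c + b * d * tr u) u"
    unfolding * by (simp add: bilinear mult_self[of u] algebra_simps)
  then show "x * y \<in> span {u, 1}" by (auto simp: in_span_one_gen)
qed (auto intro: span_base)

lemma complemented_span_one_gen:
  assumes "disc u \<noteq> 0"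
  shows "complemented (span {u, 1})"
  unfolding complemented_def
proof
  fix z
  define p q where "p = tr z" and "q = bil z u"
  \<comment> \<open>Cramer's rule for the Gram matrix of \<open>1, u\<close>, whose determinant is \<open>- disc u\<close>.\<close>
  define a where "a = (tr u * q - 2 * nrm u * p) / disc u"
  define b where "b = (tr u * p - 2 * q) / disc u"
  have "p - (2 * a + b * tr u) = 0" "q - (a * tr u + b * (2 * nrm u)) = 0"
    using assms by (simp_all add: a_def b_def field_simps) (simp_all add: disc_def algebra_simps)
  then have "bil (z - (scale a 1 + scale b u)) 1 = 0" "bil (z - (scale a 1 + scale b u)) u = 0"
    by (simp_all add: bil_self p_def q_def algebra_simps)
  then have "z - (scale a 1 + scale b u) \<in> perp (span {u, 1})"
    by (auto simp: perp_def in_span_one_gen simp del: bil_linear(3))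
  then show "\<exists>d\<in>span {u, 1}. z - d \<in> perp (span {u, 1})"
    using span_one_genI by blast
qed

lemma bar_eq_self_disc:
  assumes "bar u = u"
  shows "disc u = 0"
proof -
  have "scale (tr u) 1 * scale (tr u) 1 = (u + u) * (u + u)"
    using add_bar[of u] assms by simp
  also have "\<dots> = scale (4 * nrm u) 1"
  proof -
    have "u * u = scale (nrm u) 1" using mult_bar[of u] assms by simp
    moreover have "(4::'f) = 1 + 1 + 1 + 1" by simp
    ultimately show ?thesis by (simp only: bilinear distrib_right scale_left_distrib mult_1_left) (simp add: algebra_simps)
  qed
  finally show ?thesis by (simp add: bilinear disc_def)
qed

end

context octonion_division_algebra
begin

text \<open>Completing the square: \<open>(2 x - tr x)\<^sup>2 = disc x\<close>.\<close>
lemma disc_zero: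
  assumes "disc x = 0"
  shows "x \<in> scalars scale \<or> (2::'f) = 0 \<and> tr x = 0"
proof (cases "(2::'f) = 0")
  case True
  moreover have "(4::'f) = 2 * 2" by simp
  ultimately show ?thesis using assms by (simp add: disc_def)
next
  case False
  define s where "s = scale 2 x - scale (tr x) 1"
  have "s * s = scale (disc x) 1"
    by (simp add: s_def disc_def bilinear mult_self[of x] algebra_simps)
       (simp flip: scale_left_distrib)
  then have "s = 0" using assms by simp
  then have "scale (inverse 2) (scale 2 x) = scale (inverse 2) (scale (tr x) 1)" by (simp add: s_def)
  then have "x = scale (tr x / 2) 1" using False by (simp add: field_simps)
  then show ?thesis by (metis scalarsI)
qed

lemma scalars_commute: "x \<in> scalars scale \<Longrightarrow> x * y = y * x"
  by (auto simp: bilinear elim: scalarsE)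

text \<open>In characteristic 2 noncommuting elements may both have discriminant zero; then their product
  has nonzero trace, because \<open>tr (x * y) = x * y + y * x\<close>.\<close>
lemma disc_noncommuting:
  assumes "x * y \<noteq> y * x" "disc x = 0" "disc y = 0"
  shows "disc (x * y) \<noteq> 0"
proof
  assume 0: "disc (x * y) = 0"
  have "x \<notin> scalars scale" "y \<notin> scalars scale"
    using assms(1) scalars_commute by metis+
  then have 2: "(2::'f) = 0" and t: "tr x = 0" "tr y = 0" using disc_zero assms by blast+
  moreover have "(4::'f) = 2 * 2" by simp
  ultimately have "tr (x * y) = 0" using 0 by (simp add: disc_def)
  moreover have "bar x = - x" "bar y = - y" using t by (simp_all add: bar_eq)
  ultimately have "x * y + y * x = 0" using add_bar[of "x * y"] by simp
  moreover have "x * y + x * y = 0" using 2 by (metis one_add_one scale_left_distrib scale_one scale_zero_left)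
  ultimately show False using assms(1) by (metis add_left_cancel)
qed

lemma exists_disc: "\<exists>u. disc u \<noteq> 0"
  using not_commutative disc_noncommuting by metis

lemma perp_exists:
  assumes "complemented D" "D \<noteq> UNIV"
  obtains v where "v \<in> perp D" "v \<noteq> 0"
proof -
  obtain z where "z \<notin> D" using assms by blast
  obtain d where "d \<in> D" "z - d \<in> perp D" using assms(1) unfolding complemented_def by blast
  with \<open>z \<notin> D\<close> that[of "z - d"] show ?thesis by auto
qed

context
  fixes u v :: 'o and K Q :: "'o set"
  assumes u: "disc u \<noteq> 0" and v: "v \<in> perp K" "v \<noteq> 0"
    and K: "K = span {u, 1}" and Q: "Q = double K v"
begin

text \<open>\<open>K\<close> is a separable quadratic subalgebra and \<open>Q = K + K v\<close> is shown to be a quaternion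
  subalgebra.\<close>

lemmas subalgebra_K = subalgebra_span_one_gen[of u, folded K]
lemmas complemented_K = complemented_span_one_gen[OF u, folded K]

lemma bar_u: "bar u \<noteq> u"
  using u bar_eq_self_disc by blast

lemma u_in: "u \<in> K"
  by (simp add: K span_base)

lemmas in_K = subalgebra_in[OF subalgebra_K] subalgebra_bar[OF subalgebra_K]
lemmas K_mult = perp_double_mult[OF subalgebra_K v(1)]
lemmas K_unique = double_unique[OF subalgebra_K complemented_K v]

lemma subalgebra_Q: "subalgebra scale Q"
  unfolding Q by (rule subalgebra_double[OF subalgebra_K v(1)])

lemma complemented_Q: "complemented Q"
  unfolding Q by (rule complemented_double[OF subalgebra_K complemented_K v])

lemma v_in_Q: "v \<in> Q" and K_subset_Q: "K \<subseteq> Q"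
  using double_gen[OF subalgebra_K v(1)] double_base[OF subalgebra_K v(1)] by (auto simp: Q)

lemma Q_noncommuting: "v * u \<noteq> u * v"
  using perp_commute[OF subalgebra_K v(1) u_in] mult_right_cancel[OF v(2)] bar_u by simp

lemma Q_associative:
  assumes "x \<in> Q" "y \<in> Q" "z \<in> Q"
  shows "(x * y) * z = x * (y * z)"
proof -
  have c: "a * b = b * a" if "a \<in> K" "b \<in> K" for a b using that unfolding K by (rule span_one_gen_commute)
  have as: "(a * b) * c = a * (b * c)" if "a \<in> K" "b \<in> K" "c \<in> K" for a b c
    using that by (rule perp_associative[OF subalgebra_K v])
  have lc: "a * (b * c) = b * (a * c)" if "a \<in> K" "b \<in> K" "c \<in> K" for a b c
    using that as c by metis
  obtain a b c d e f where *: "a \<in> K" "b \<in> K" "c \<in> K" "d \<in> K" "e \<in> K" "f \<in> K"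
    and x: "x = a + b * v" and y: "y = c + d * v" and z: "z = e + f * v"
    using assms by (auto simp: Q double_def)
  have xy: "x * y = (a * c + scale (- nrm v) (bar d * b)) + (d * a + b * bar c) * v"
    unfolding x y using * by (intro K_mult)
  have yz: "y * z = (c * e + scale (- nrm v) (bar f * d)) + (f * c + d * bar e) * v"
    unfolding z y using * by (intro K_mult)
  show ?thesis unfolding xy yz unfolding x z using *
    by (subst (1 2) K_mult) (simp_all add: in_K bilinear c as lc algebra_simps)
qed

lemma Q_center: "{z \<in> Q. \<forall>x\<in>Q. z * x = x * z} = scalars scale"
proof (intro equalityI subsetI)
  fix z assume "z \<in> {z \<in> Q. \<forall>x\<in>Q. z * x = x * z}"
  then have "z \<in> Q" and c: "z * u = u * z" "z * v = v * z"
    using v_in_Q K_subset_Q u_in by blast+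
  then obtain a b where ab: "a \<in> K" "b \<in> K" "z = a + b * v"
    by (auto simp: Q double_def)
  have e: "a * u + (b * bar u) * v = u * a + (b * u) * v"
    using c(1) K_mult[of a b u 0] K_mult[of u 0 a b] ab u_in by (simp add: in_K)
  have "b * bar u = b * u"
    using ab u_in by (intro K_unique[OF _ _ _ _ e, THEN conjunct2]) (simp_all add: in_K)
  then have "b = 0" using bar_u mult_left_cancel by blast
  then have "a * v = bar a * v"
    using c(2) ab perp_commute[OF subalgebra_K v(1)] by simp
  then have a: "bar a = a" using v(2) by (simp add: mult_right_cancel)
  obtain p q where pq: "a = scale p 1 + scale q u" using ab by (auto simp: K in_span_one_gen)
  then have "q = 0" using a bar_u by simp
  then show "z \<in> scalars scale" using ab pq \<open>b = 0\<close> by simp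
next
  fix z assume z: "z \<in> scalars scale"
  then have "z \<in> Q" using subalgebra_in(2,5)[OF subalgebra_Q] by (auto elim: scalarsE)
  moreover have "\<forall>x\<in>Q. z * x = x * z" using scalars_commute[OF z] by blast
  ultimately show "z \<in> {z \<in> Q. \<forall>x\<in>Q. z * x = x * z}" by blast
qed

lemma Q_dim: "dim Q = 4"
proof (rule dim_unique[of "{u * v, v, u, 1}"])
  have u1: "u \<notin> span {1}" using bar_u by (auto simp: span_singleton)
  have v1: "v \<notin> K" using complemented_perp_disjoint[OF complemented_K] v by blast
  have uv: "u * v \<notin> span {v, u, 1}"
  proof
    assume "u * v \<in> span {v, u, 1}"
    then obtain k where k: "u * v - scale k v \<in> K" unfolding K span_breakdown_eq[of _ v] by blast
    have e: "0 + (u - scale k 1) * v = (u * v - scale k v) + 0 * v" by (simp add: bilinear)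
    have "u - scale k 1 = 0"
      using u_in k by (intro K_unique[OF _ _ _ _ e, THEN conjunct2]) (simp_all add: in_K)
    then show False using u1 by (auto simp: span_singleton)
  qed
  have ind: "independent {u, 1}" using u1 by (intro independent_insertI independent_empty) simp_all
  show "independent {u * v, v, u, 1}"
    using independent_insertI[OF uv independent_insertI[OF v1[unfolded K] ind]] by simp
  have "u \<notin> {1}" "v \<notin> {u, 1}" "u * v \<notin> {v, u, 1}"
    using u1 v1 uv unfolding K by (blast intro: span_base)+
  then show "card {u * v, v, u, 1} = 4" by simp
  show "{u * v, v, u, 1} \<subseteq> Q"
    using v_in_Q K_subset_Q u_in subalgebra_in[OF subalgebra_Q] by auto
  show "Q \<subseteq> span {u * v, v, u, 1}"
  proof
    fix x assume "x \<in> Q"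
    then obtain a b c d where "x = (scale a 1 + scale b u) + (scale c 1 + scale d u) * v"
      by (auto simp: Q K double_def in_span_one_gen)
    then have "x = scale a 1 + scale b u + (scale c v + scale d (u * v))" by (simp add: bilinear)
    then show "x \<in> span {u * v, v, u, 1}" by (simp add: span_add span_scale span_base)
  qed
qed

lemma quaternion_subalgebra_Q: "quaternion_subalgebra scale Q"
  unfolding quaternion_subalgebra_def
proof (intro conjI ballI allI impI)
  fix I assume I: "two_sided_ideal scale Q I"
  show "I = {0} \<or> I = Q"
  proof (cases "I = {0}")
    case False
    have sI: "subspace I" using I by (simp add: two_sided_ideal_def)
    then obtain z where z: "z \<in> I" "z \<noteq> 0" using False subspace_0[OF sI] by blast
    then have "z \<in> Q" using I by (auto simp: two_sided_ideal_def)
    then have "bar z * z \<in> I" using z I subalgebra_bar[OF subalgebra_Q] by (auto simp: two_sided_ideal_def)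
    then have "scale (inverse (nrm z)) (scale (nrm z) 1) \<in> I"
      using subspace_scale[OF sI] by (simp add: mult_bar del: scale_scale)
    then have "1 \<in> I" using z by simp
    then have "x \<in> I" if "x \<in> Q" for x using that I mult_one_right[of x] unfolding two_sided_ideal_def by metis
    then show ?thesis using I by (auto simp: two_sided_ideal_def)
  qed simp
qed (use subalgebra_Q Q_associative Q_dim Q_center in auto)

text \<open>As \<open>Q\<close> is associative and the whole algebra is not, there is a nonzero \<open>l\<close> orthogonal to \<open>Q\<close>.
  If \<open>Q + Q l\<close> were not everything, it would be associative as well, which would force \<open>Q\<close> to be
  commutative.\<close>
lemma Q_cayley_dickson:
  obtains l \<gamma> where "cayley_dickson scale bar Q l \<gamma>" "l + bar l = 0"
proof -
  have "Q \<noteq> UNIV" using not_associative Q_associative by (metis UNIV_I)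
  then obtain l where l: "l \<in> perp Q" "l \<noteq> 0" using perp_exists complemented_Q by metis
  have all: "double Q l = UNIV"
  proof (rule ccontr)
    note sub2 = subalgebra_double[OF subalgebra_Q l(1)]
    assume "double Q l \<noteq> UNIV"
    then obtain m where m: "m \<in> perp (double Q l)" "m \<noteq> 0"
      using perp_exists complemented_double[OF subalgebra_Q complemented_Q l] by metis
    have Q2: "u \<in> Q" "v \<in> Q" "u \<in> double Q l" "v \<in> double Q l" "l \<in> double Q l"
      using K_subset_Q u_in v_in_Q double_base[OF subalgebra_Q l(1)] double_gen[OF subalgebra_Q l(1)]
      by auto
    have "(u * v) * l = u * (v * l)" using Q2 by (intro perp_associative[OF sub2 m])
    also have "\<dots> = (v * u) * l" using Q2 by (intro perp_left_mult[OF subalgebra_Q l(1)])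
    finally show False using l Q_noncommuting by (simp add: mult_right_cancel)
  qed
  have ds: "direct_sum_with Q l"
    unfolding direct_sum_with_def
  proof
    fix x
    have "x \<in> double Q l" using all by simp
    then obtain a b where ab: "a \<in> Q" "b \<in> Q" "x = a + b * l" by (auto simp: double_def)
    show "\<exists>!p. p \<in> Q \<times> Q \<and> x = fst p + snd p * l"
    proof (rule ex1I[of _ "(a, b)"])
      fix p assume p: "p \<in> Q \<times> Q \<and> x = fst p + snd p * l"
      then have e: "fst p + snd p * l = a + b * l" using ab by simp
      have "fst p = a \<and> snd p = b"
        using p ab(1,2) by (intro double_unique[OF subalgebra_Q complemented_Q l _ _ _ _ e]) auto
      then show "p = (a, b)" by (metis prod.collapse)
    qed (use ab in simp)
  qed
  have "standard_involution_on scale Q bar"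
    unfolding standard_involution_on_def
    using subalgebra_bar[OF subalgebra_Q] by (auto simp: add_bar mult_bar)
  then have "cayley_dickson scale bar Q l (- nrm l)"
    unfolding cayley_dickson_def using quaternion_subalgebra_Q ds l
      perp_double_mult[OF subalgebra_Q l(1)] perp_double_bar[OF subalgebra_Q l(1)] by simp
  moreover have "l + bar l = 0" using perp_bar[OF subalgebra_Q l(1)] by simp
  ultimately show ?thesis by (rule that)
qed

end

text \<open>The whole algebra is the double of the quaternion subalgebra \<open>Q\<close> by the pure element \<open>l\<close>.\<close>
definition quaternion_double :: "'o set \<Rightarrow> 'o \<Rightarrow> bool" where
  "quaternion_double Q l \<longleftrightarrow> (\<exists>\<gamma>. cayley_dickson scale bar Q l \<gamma>) \<and> l + bar l = 0"

lemma quaternion_double_subalgebra: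
  assumes "quaternion_double Q l"
  shows "subalgebra scale Q"
  using assms by (auto simp: quaternion_double_def cayley_dickson_def quaternion_subalgebra_def)

text \<open>The vector \<open>v\<close> of the construction is the component of \<open>w\<close> orthogonal to the quadratic subalgebra
  generated by \<open>u\<close>, or arbitrary when this component vanishes.\<close>
lemma separable_pair_quaternion:
  assumes u: "disc u \<noteq> 0"
  shows "\<exists>Q l. quaternion_double Q l \<and> u \<in> Q \<and> w \<in> Q"
proof -
  let ?K = "span {u, 1}"
  note sub = subalgebra_span_one_gen[of u] and c = complemented_span_one_gen[OF u]
  obtain d where d: "d \<in> ?K" "w - d \<in> perp ?K" using c unfolding complemented_def by blast
  obtain v where v: "v \<in> perp ?K" "v \<noteq> 0" "w - d = 0 \<or> v = w - d"
  proof (cases "w - d = 0")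
    case True
    have "?K \<noteq> UNIV" using not_commutative span_one_gen_commute by (metis UNIV_I)
    then show ?thesis using that True perp_exists[OF c] by metis
  qed (use d that in blast)
  have "w = d + (w - d)" by simp
  moreover have "d + (w - d) \<in> double ?K v"
    using v(3) doubleI[OF sub v(1) d(1), of 0] doubleI[OF sub v(1) d(1), of 1]
    by (auto simp: subalgebra_in[OF sub])
  ultimately have "w \<in> double ?K v" by simp
  moreover have "u \<in> double ?K v" using K_subset_Q[OF u v(1,2) refl refl] u_in[OF u v(1,2) refl refl] by auto
  moreover obtain l \<gamma> where "cayley_dickson scale bar (double ?K v) l \<gamma>" "l + bar l = 0"
    using Q_cayley_dickson[OF u v(1,2) refl refl] .
  ultimately show ?thesis unfolding quaternion_double_def by blast
qed

text \<open>If \<open>1, x, y\<close> are linearly dependent, then \<open>w\<close> can be taken to be \<open>x\<close> or \<open>y\<close>.\<close>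
lemma dependent_pair:
  assumes "dim {1, x, y} \<noteq> 3"
  shows "\<exists>w. x \<in> span {w, 1} \<and> y \<in> span {w, 1}"
proof (rule ccontr)
  assume no: "\<not> ?thesis"
  have y: "y \<notin> span {x, 1}" using no by (auto intro: span_base)
  have x: "x \<notin> span {1}"
  proof
    assume "x \<in> span {1}"
    then have "x \<in> span {y, 1}" using span_mono[of "{1}" "{y, 1}"] by auto
    then show False using no by (auto intro: span_base)
  qed
  have "independent {x, 1}" using x by (intro independent_insertI independent_empty) simp_all
  then have "independent {y, x, 1}" by (rule independent_insertI[OF y])
  then have "dim {y, x, 1} = card {y, x, 1}" by (rule dim_eq_card_independent)
  moreover have "y \<notin> {x, 1}" "x \<notin> {1}" using x y by (auto intro: span_base)
  ultimately have "dim {y, x, 1} = 3" by simp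
  moreover have "{y, x, 1} = {1, x, y}" by auto
  ultimately show False using assms by simp
qed

text \<open>It suffices to find an element of nonzero discriminant and a second element such that any
  subalgebra containing both contains \<open>x\<close> and \<open>y\<close>. Only commuting pairs of trace zero in
  characteristic 2 that are linearly independent modulo scalars admit none.\<close>
lemma pair_quaternion:
  assumes "\<not> inseparable_pair scale x y"
  shows "\<exists>Q l. quaternion_double Q l \<and> x \<in> Q \<and> y \<in> Q"
proof -
  consider "disc x \<noteq> 0" | "disc y \<noteq> 0" | "disc x = 0" "disc y = 0" "x * y \<noteq> y * x"
    | "disc x = 0" "disc y = 0" "x * y = y * x" by blast
  then show ?thesis
  proof cases
    case 1
    then show ?thesis by (rule separable_pair_quaternion)
  next
    case 2
    then show ?thesis using separable_pair_quaternion by blast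
  next
    case 3
    then have "disc (x * y) \<noteq> 0" by (intro disc_noncommuting)
    then obtain Q l where Q: "quaternion_double Q l" "x * y \<in> Q" "x \<in> Q"
      using separable_pair_quaternion by blast
    note sub = quaternion_double_subalgebra[OF Q(1)]
    have "scale (inverse (nrm x)) (bar x * (x * y)) \<in> Q"
      using Q by (simp only: subalgebra_in[OF sub] subalgebra_bar[OF sub])
    moreover have "x \<noteq> 0" using 3 by auto
    ultimately have "y \<in> Q" by simp
    then show ?thesis using Q by blast
  next
    case 4
    obtain w where w: "x \<in> span {w, 1}" "y \<in> span {w, 1}"
    proof (cases "(2::'f) = 0")
      case True
      then show ?thesis using dependent_pair[of x y] assms 4 that by (auto simp: inseparable_pair_def)
    next
      case False
      then have "x \<in> scalars scale" "y \<in> scalars scale" using disc_zero 4 by blast+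
      then show ?thesis using that[of 1] by (auto simp: scalars_def span_singleton)
    qed
    obtain u where "disc u \<noteq> 0" using exists_disc by blast
    then obtain Q l where Q: "quaternion_double Q l" "w \<in> Q"
      using separable_pair_quaternion by blast
    note sub = quaternion_double_subalgebra[OF Q(1)]
    have "span {w, 1} \<subseteq> Q" using Q sub by (intro span_minimal) (auto simp: subalgebra_def)
    then show ?thesis using w Q by blast
  qed
qed

section \<open>Roots of a quadratic polynomial and of its conjugate\<close>

lemma quadratic_root_iff: "quadratic_root c1 c0 x \<longleftrightarrow> x * x + c1 * x + c0 = (0::'o)"
  by (simp add: quadratic_root_def numeral_2_eq_2)

text \<open>Since a root \<open>x\<close> also satisfies \<open>x * x = tr x x - nrm x\<close>, it satisfies a linear equation. So the
  coefficients together with trace and norm determine the root, unless \<open>c1 = - tr x\<close>.\<close>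
lemma root_linear:
  assumes "quadratic_root c1 c0 x"
  shows "(scale (tr x) 1 + c1) * x = scale (nrm x) 1 - c0"
proof -
  have "scale (tr x) x - scale (nrm x) 1 + c1 * x + c0 = 0"
    using assms by (simp add: quadratic_root_iff mult_self[of x])
  then show ?thesis by (simp add: bilinear eq_diff_eq algebra_simps)
qed

lemma root_linear_nonzero:
  assumes root: "quadratic_root c1 c0 x"
    and "\<not> (c0 \<in> scalars scale \<and> c1 \<in> scalars scale)"
  shows "scale (tr x) 1 + c1 \<noteq> 0"
proof
  assume 0: "scale (tr x) 1 + c1 = 0"
  then have "c1 = scale (- tr x) 1" by (simp add: eq_neg_iff_add_eq_0 add.commute)
  moreover have "c0 = scale (nrm x) 1" using root_linear[OF root] 0 by simp
  ultimately show False using assms(2) by blast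
qed

lemma conjugacy_classI:
  assumes "q \<noteq> 0" "q * y = z * (q::'o)"
  shows "z \<in> conjugacy_class y"
proof -
  define q' where "q' = scale (inverse (nrm q)) (bar q)"
  have "q * q' = 1" "q' * q = 1" "(q * y) * q' = z"
    using assms by (simp_all add: q'_def bilinear mult_bar)
  then show ?thesis using assms(1) unfolding conjugacy_class_def by blast
qed

context
  fixes Q :: "'o set" and l :: 'o and \<gamma> :: 'f
  assumes cd: "cayley_dickson scale bar Q l \<gamma>"
begin

lemma Q_doubled: "doubled_algebra scale bar Q l \<gamma>"
  using cd unital_algebra_axioms by (simp add: doubled_algebra_def doubled_algebra_axioms_def)

lemmas in_Q = doubled_algebra.in_A[OF Q_doubled]
lemmas assoc_Q = doubled_algebra.assocA[OF Q_doubled]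

lemma power_in_Q: "x \<in> Q \<Longrightarrow> x ^ k \<in> Q"
  by (induction k) (simp_all add: in_Q)

lemma power_commute_Q: "x \<in> Q \<Longrightarrow> x ^ k * x = x * x ^ k"
  by (induction k) (simp_all add: in_Q assoc_Q power_in_Q)

lemma bar_power_Q: "x \<in> Q \<Longrightarrow> bar (x ^ k) = bar x ^ k"
  by (induction k) (simp_all add: power_commute_Q in_Q)

lemma nrm_mult_Q:
  assumes "x \<in> Q" "y \<in> Q"
  shows "nrm (x * y) = nrm x * nrm y"
proof (rule nrm_eqI)
  have "(x * y) * bar (x * y) = ((x * y) * bar y) * bar x"
    using assms assoc_Q[of "x * y" "bar y" "bar x"] by (simp add: in_Q)
  then show "(x * y) * bar (x * y) = scale (nrm x * nrm y) 1"
    by (simp add: bilinear mult_bar mult.commute)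
qed

text \<open>Elements of \<open>Q\<close> with the same trace and norm are conjugate, with explicit conjugating elements
  \<open>z - bar y\<close> or, when this vanishes, a commutator
  with \<open>y\<close> (or \<open>1\<close> for scalar \<open>y\<close>).\<close>
lemma conjugate_in_Q:
  assumes yz: "y \<in> Q" "z \<in> Q" and tr: "tr z = tr y" and nrm: "nrm z = nrm y"
  shows "z \<in> conjugacy_class y"
proof (cases "z = bar y")
  case False
  have "(z - bar y) * y = z * (z - bar y)"
    using tr nrm by (simp add: bilinear mult_bar mult_self[of z] mult_self[of y] bar_eq[of y])
  then show ?thesis using False by (intro conjugacy_classI[of "z - bar y"]) auto
next
  case bar: True
  show ?thesis
  proof (cases "y \<in> scalars scale")
    case True
    then have "bar y = y" by (auto elim: scalarsE)
    then show ?thesis using bar by (intro conjugacy_classI[of 1]) auto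
  next
    case False
    have "{z \<in> Q. \<forall>x\<in>Q. z * x = x * z} = scalars scale"
      using cd by (simp add: cayley_dickson_def quaternion_subalgebra_def)
    then obtain w where w: "w \<in> Q" "y * w \<noteq> w * y" using False yz by blast
    have "(w * y - y * w) * y = w * (y * y) - y * (w * y)"
      using w yz by (simp add: bilinear assoc_Q)
    also have "\<dots> = bar y * (w * y) - bar y * (y * w)"
      by (simp add: bilinear mult_self[of y]) (simp add: bar_eq[of y] bilinear)
    finally show ?thesis using w bar
      by (intro conjugacy_classI[of "w * y - y * w"]) (auto simp: bilinear)
  qed
qed

text \<open>The root \<open>y\<close> of the conjugate polynomial solves \<open>bar X * y = bar (X * x)\<close> for
  \<open>X = tr x + c1\<close>; equivalently, \<open>y\<close> is the conjugate of \<open>bar x\<close> by \<open>X\<close>.\<close>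
lemma conjugate_root:
  assumes in_Q': "c0 \<in> Q" "c1 \<in> Q" "x \<in> Q" and root: "quadratic_root c1 c0 x"
    and nz: "scale (tr x) 1 + c1 \<noteq> 0"
  obtains y where "y \<in> Q" "quadratic_root (bar c1) (bar c0) y" "tr y = tr x" "nrm y = nrm x"
proof -
  define X where "X = scale (tr x) 1 + c1"
  define y where "y = scale (inverse (nrm X)) (X * bar (X * x))"
  have X: "X \<in> Q" "X \<noteq> 0" "X * x = scale (nrm x) 1 - c0"
    using in_Q' nz root_linear[OF root] by (simp_all add: X_def in_Q)
  have "y \<in> Q" using X in_Q' by (simp add: y_def in_Q del: bar_mult)
  moreover have tr: "tr y = tr x"
  proof -
    have "X * bar (X * x) = (X * bar x) * bar X"
      using X(1) in_Q' by (simp only: bar_mult assoc_Q in_Q)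
    then have "tr (X * bar (X * x)) = tr (bar X * (X * bar x))" by (simp only: tr_mult_commute)
    then show ?thesis using X by (simp add: y_def del: bar_mult)
  qed
  moreover have nrm: "nrm y = nrm x"
    using X in_Q' nrm_mult_Q[of X "bar (X * x)"] nrm_mult_Q[of X x]
    by (simp add: y_def in_Q field_simps del: bar_mult)
  moreover have "quadratic_root (bar c1) (bar c0) y"
  proof -
    have "bar X * y = bar (X * x)" using X(2) by (simp add: y_def bilinear del: bar_mult)
    also have "\<dots> = scale (nrm x) 1 - bar c0" using X by (simp del: bar_mult)
    finally have "scale (tr x) y + bar c1 * y = scale (nrm x) 1 - bar c0"
      by (simp add: X_def bilinear)
    then show ?thesis by (simp add: quadratic_root_iff mult_self[of y] tr nrm algebra_simps)
  qed
  ultimately show ?thesis using that by blast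
qed

lemma conjugate_roots:
  assumes in_Q': "c0 \<in> Q" "c1 \<in> Q" "x \<in> Q" "x' \<in> Q"
    and root: "quadratic_root c1 c0 x" "quadratic_root c1 c0 x'" and neq: "x \<noteq> x'"
  obtains y y' where "y \<in> Q" "y' \<in> Q" "quadratic_root (bar c1) (bar c0) y"
    "quadratic_root (bar c1) (bar c0) y'" "y \<noteq> y'"
    "y \<in> conjugacy_class x" "y' \<in> conjugacy_class x'"
proof (cases "c0 \<in> scalars scale \<and> c1 \<in> scalars scale")
  case True
  then have "bar c0 = c0" "bar c1 = c1" by (auto elim!: scalarsE)
  then show ?thesis using that[of x x'] assms conjugate_in_Q by simp
next
  case False
  have nz: "scale (tr w) 1 + c1 \<noteq> 0" if "quadratic_root c1 c0 w" for w
    using False root_linear_nonzero that by blast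
  obtain y where y: "y \<in> Q" "quadratic_root (bar c1) (bar c0) y" "tr y = tr x" "nrm y = nrm x"
    using conjugate_root[OF in_Q'(1,2,3) root(1) nz[OF root(1)]] .
  obtain y' where y': "y' \<in> Q" "quadratic_root (bar c1) (bar c0) y'" "tr y' = tr x'" "nrm y' = nrm x'"
    using conjugate_root[OF in_Q'(1,2,4) root(2) nz[OF root(2)]] .
  have "y \<noteq> y'"
  proof
    assume "y = y'"
    then have "(scale (tr x) 1 + c1) * x = (scale (tr x) 1 + c1) * x'"
      using y y' root_linear[OF root(1)] root_linear[OF root(2)] by simp
    then show False using neq mult_left_cancel[OF nz[OF root(1)]] by blast
  qed
  then show ?thesis using that y y' in_Q' conjugate_in_Q by blast
qed

section \<open>Solution of the recurrence\<close>

lemma solve_initial: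
  assumes "x \<in> Q" "x' \<in> Q" "x \<noteq> x'" "p \<in> Q" "q \<in> Q"
  obtains b b' where "b \<in> Q" "b' \<in> Q" "b + b' = p" "x * b + x' * b' = q"
proof -
  define d where "d = x' - x"
  \<comment> \<open>Eliminating \<open>b = p - b'\<close> leaves the equation \<open>d * b' = q - x * p\<close>.\<close>
  define b' where "b' = scale (inverse (nrm d)) (bar d * (q - x * p))"
  have d: "d \<noteq> 0" "d \<in> Q" using assms by (simp_all add: d_def in_Q)
  have "b' \<in> Q" using d assms by (simp add: b'_def in_Q)
  moreover have "d * b' = q - x * p" using d by (simp add: b'_def bilinear linear_simps)
  then have "x * (p - b') + x' * b' = q" by (simp add: d_def bilinear algebra_simps)
  ultimately show ?thesis using that[of "p - b'" b'] assms by (simp add: in_Q)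
qed

lemma root_recurrence:
  assumes "c0 \<in> Q" "c1 \<in> Q" "x \<in> Q" "b \<in> Q" and root: "quadratic_root c1 c0 x"
  shows "x ^ (k + 2) * b = - (c0 * (x ^ k * b)) - c1 * (x ^ (k + 1) * b)"
proof -
  have "(x * x + c1 * x + c0) * (x ^ k * b) = 0" using root by (simp add: quadratic_root_iff)
  then show ?thesis using assms
    by (simp add: bilinear assoc_Q in_Q power_in_Q eq_neg_iff_add_eq_0 algebra_simps)
qed

text \<open>Writing \<open>a k = U k + bar (V k) * l\<close>, the part \<open>U\<close> satisfies the given recurrence in the
  associative algebra \<open>Q\<close>. Multiplication from the left acts on the coefficient of \<open>l\<close> from the right,
  hence \<open>V\<close> satisfies the recurrence with conjugate coefficients.\<close>
lemma recurrence_solution: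
  assumes in_Q': "c0 \<in> Q" "c1 \<in> Q" "x \<in> Q" "x' \<in> Q" "y \<in> Q" "y' \<in> Q"
    and root: "quadratic_root c1 c0 x" "quadratic_root c1 c0 x'" "x \<noteq> x'"
    and root': "quadratic_root (bar c1) (bar c0) y" "quadratic_root (bar c1) (bar c0) y'" "y \<noteq> y'"
    and rec: "left_recurrence c0 c1 a"
  shows "\<exists>b1\<in>Q. \<exists>b2\<in>Q. \<exists>c1'\<in>Q. \<exists>c2'\<in>Q. \<forall>k.
    a k = x ^ k * b1 + x' ^ k * b2 + (c1' * bar y ^ k + c2' * bar y' ^ k) * l"
proof -
  note dbl = doubled_algebra.dbl[OF Q_doubled]
  obtain p r where 0: "p \<in> Q" "r \<in> Q" "a 0 = p + r * l" by (rule doubled_algebra.dblE[OF Q_doubled])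
  obtain q s where 1: "q \<in> Q" "s \<in> Q" "a 1 = q + s * l" by (rule doubled_algebra.dblE[OF Q_doubled])
  obtain b b' where b: "b \<in> Q" "b' \<in> Q" "b + b' = p" "x * b + x' * b' = q"
    using solve_initial[OF in_Q'(3,4) root(3) 0(1) 1(1)] .
  obtain c c' where c: "c \<in> Q" "c' \<in> Q" "c + c' = bar r" "y * c + y' * c' = bar s"
    using solve_initial[OF in_Q'(5,6) root'(3), of "bar r" "bar s"] 0 1 by (auto simp: in_Q)
  define U where "U k = x ^ k * b + x' ^ k * b'" for k
  define V where "V k = y ^ k * c + y' ^ k * c'" for k
  have UV: "U k \<in> Q" "V k \<in> Q" for k
    using b c in_Q' by (simp_all add: U_def V_def in_Q power_in_Q)
  have U: "U (k + 2) = - (c0 * U k) - c1 * U (k + 1)" for k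
    using root_recurrence[OF in_Q'(1,2,3) b(1) root(1), of k]
      root_recurrence[OF in_Q'(1,2,4) b(2) root(2), of k]
    by (simp add: U_def bilinear algebra_simps)
  have V: "V (k + 2) = - (bar c0 * V k) - bar c1 * V (k + 1)" for k
    using root_recurrence[of "bar c0" "bar c1" y c k] root_recurrence[of "bar c0" "bar c1" y' c' k]
      in_Q' c root' by (simp add: V_def bilinear in_Q algebra_simps)
  have step: "z * (U k + bar (V k) * l) = z * U k + bar (bar z * V k) * l" if "z \<in> Q" for z k
    using dbl[of z 0 "U k" "bar (V k)"] that UV by (simp add: in_Q)
  have sol: "a k = U k + bar (V k) * l \<and> a (k + 1) = U (k + 1) + bar (V (k + 1)) * l" for k
  proof (induction k)
    case 0
    show ?case using \<open>a 0 = p + r * l\<close> \<open>a 1 = q + s * l\<close> b c by (simp add: U_def V_def flip: bar_add)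
  next
    case (Suc k)
    have "a (k + 2) = - (c0 * a k) - c1 * a (k + 1)" using rec by (simp add: left_recurrence_def)
    also have "\<dots> = U (k + 2) + bar (V (k + 2)) * l"
      using Suc step in_Q' U[of k] V[of k] by (simp add: bilinear del: bar_mult)
    finally show ?case using Suc by simp
  qed
  have "bar (V k) = bar c * bar y ^ k + bar c' * bar y' ^ k" for k
    using in_Q' by (simp add: V_def bar_power_Q)
  then have "\<forall>k. a k = x ^ k * b + x' ^ k * b' + (bar c * bar y ^ k + bar c' * bar y' ^ k) * l"
    using sol by (simp add: U_def)
  moreover have "bar c \<in> Q" "bar c' \<in> Q" using c by (simp_all add: in_Q)
  ultimately show ?thesis using b by blast
qed

end

text \<open>For scalar coefficients and commuting roots, \<open>(x - y) * (x + y + c1) = 0\<close>.\<close>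
lemma scalar_roots_not_inseparable:
  assumes c: "c0 \<in> scalars scale" "c1 \<in> scalars scale"
    and root: "quadratic_root c1 c0 x" "quadratic_root c1 c0 y" and neq: "x \<noteq> y"
  shows "\<not> inseparable_pair scale x y"
proof
  assume "inseparable_pair scale x y"
  then have xy: "x * y = y * x" and dim: "dim {1, x, y} = 3" by (auto simp: inseparable_pair_def)
  obtain s where s: "c1 = scale s 1" using c by (auto elim: scalarsE)
  have "(x - y) * (x + y + c1) = (x * x + c1 * x + c0) - (y * y + c1 * y + c0)"
    by (simp add: bilinear linear_simps s xy)
  also have "\<dots> = 0" using root by (simp add: quadratic_root_iff)
  finally have "x + y + c1 = 0" using neq by simp
  then have "y = scale (- s) 1 + scale (- 1) x" by (simp add: s algebra_simps eq_neg_iff_add_eq_0)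
  then have "{1, x, y} \<subseteq> span {x, 1}" using span_one_genI[of "- s" "- 1" x] by (auto intro: span_base)
  then have "dim {1, x, y} \<le> card {x, 1}" by (rule dim_le_card) simp
  also have "\<dots> \<le> 2" by (simp add: card_insert_if)
  finally show False using dim by simp
qed

text \<open>When the coefficients are not both scalar, the roots lie in every subalgebra containing the
  coefficients. When they are scalar, a quaternion subalgebra is chosen to contain the roots.\<close>
lemma roots_in_quaternion:
  assumes ns: "\<not> inseparable_pair scale c0 c1"
    and root: "quadratic_root c1 c0 x" "quadratic_root c1 c0 y" and neq: "x \<noteq> y"
  shows "\<exists>Q l. quaternion_double Q l \<and> c0 \<in> Q \<and> c1 \<in> Q \<and> x \<in> Q \<and> y \<in> Q"
proof (cases "c0 \<in> scalars scale \<and> c1 \<in> scalars scale")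
  case True
  then obtain Q l where Q: "quaternion_double Q l" "x \<in> Q" "y \<in> Q"
    using pair_quaternion scalar_roots_not_inseparable root neq by blast
  note sub = quaternion_double_subalgebra[OF Q(1)]
  have "c0 \<in> Q" "c1 \<in> Q" using True subalgebra_in(2,5)[OF sub] by (auto elim!: scalarsE)
  then show ?thesis using Q by blast
next
  case False
  obtain Q l where Q: "quaternion_double Q l" "c0 \<in> Q" "c1 \<in> Q" using pair_quaternion[OF ns] by blast
  note sub = quaternion_double_subalgebra[OF Q(1)]
  have "w \<in> Q" if w: "quadratic_root c1 c0 w" for w
  proof -
    define X where "X = scale (tr w) 1 + c1"
    have X: "X * w = scale (nrm w) 1 - c0" "X \<noteq> 0"
      using root_linear[OF w] root_linear_nonzero[OF w] False by (auto simp: X_def)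
    have "X \<in> Q" using Q(3) unfolding X_def by (simp only: subalgebra_in[OF sub])
    then have "scale (inverse (nrm X)) (bar X * (X * w)) \<in> Q"
      using Q(2) unfolding X(1) by (simp only: subalgebra_in[OF sub] subalgebra_bar[OF sub])
    then show ?thesis using X(2) by simp
  qed
  then show ?thesis using Q root by blast
qed

end

theorem theorem1p3:
  fixes scale :: "'f::field \<Rightarrow> 'o::{ab_group_add, power} \<Rightarrow> 'o"
    and bar :: "'o \<Rightarrow> 'o"
    and c0 c1 a0 a1 lambda1 mu1 :: 'o
    and a :: "nat \<Rightarrow> 'o"
  assumes "octonion_division_algebra scale bar"
    and "c0 \<noteq> 0"
    and "\<not> inseparable_pair scale c0 c1"
    and "left_recurrence c0 c1 a" and "a 0 = a0" and "a 1 = a1"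
    and "quadratic_root c1 c0 lambda1" and "quadratic_root c1 c0 mu1" and "lambda1 \<noteq> mu1"
  shows "\<exists>lambda2 mu2.
    quadratic_root (bar c1) (bar c0) lambda2 \<and> quadratic_root (bar c1) (bar c0) mu2 \<and>
    lambda2 \<noteq> mu2 \<and>
    lambda2 \<in> conjugacy_class lambda1 \<and> mu2 \<in> conjugacy_class mu1 \<and>
    (\<exists>Q l.
      quaternion_subalgebra scale Q \<and> c0 \<in> Q \<and> c1 \<in> Q \<and>
      l + bar l = 0 \<and> direct_sum_with Q l \<and> (\<exists>\<gamma>. cayley_dickson scale bar Q l \<gamma>) \<and>
      (\<exists>b1\<in>Q. \<exists>b2\<in>Q. \<exists>c1'\<in>Q. \<exists>c2'\<in>Q. \<forall>k.
        a k = lambda1 ^ k * b1 + mu1 ^ k * b2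
              + (c1' * bar lambda2 ^ k + c2' * bar mu2 ^ k) * l))"
proof -
  interpret octonion_division_algebra scale bar by fact
  obtain Q l where Q: "quaternion_double Q l" "c0 \<in> Q" "c1 \<in> Q" "lambda1 \<in> Q" "mu1 \<in> Q"
    using roots_in_quaternion assms by blast
  then obtain \<gamma> where cd: "cayley_dickson scale bar Q l \<gamma>" and l: "l + bar l = 0"
    by (auto simp: quaternion_double_def)
  obtain lambda2 mu2 where r: "lambda2 \<in> Q" "mu2 \<in> Q"
    "quadratic_root (bar c1) (bar c0) lambda2" "quadratic_root (bar c1) (bar c0) mu2"
    "lambda2 \<noteq> mu2" "lambda2 \<in> conjugacy_class lambda1" "mu2 \<in> conjugacy_class mu1"
    using conjugate_roots[OF cd Q(2-5) assms(7-9)] .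
  have sol: "\<exists>b1\<in>Q. \<exists>b2\<in>Q. \<exists>c1'\<in>Q. \<exists>c2'\<in>Q. \<forall>k.
        a k = lambda1 ^ k * b1 + mu1 ^ k * b2 + (c1' * bar lambda2 ^ k + c2' * bar mu2 ^ k) * l"
    by (rule recurrence_solution[OF cd Q(2-5) r(1,2) assms(7-9) r(3-5) assms(4)])
  have "quaternion_subalgebra scale Q" "direct_sum_with Q l"
    using cd by (simp_all add: cayley_dickson_def)
  then show ?thesis using Q(2,3) cd l r(3-7) sol by blast
qed

end
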